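(* Let $L$ be a lattice. Let $\rho\colon \operatorname{Dim}L\to\operatorname{Con_c}L$ be the natural monoid homomorphism, that is, the unique monoid homomorphism such that $\rho(\Delta(a,b))=\Theta(a,b)$ for all $a\leq b$ in $L$. Then $\rho$ induces an isomorphism from the maximal semilattice quotient $\operatorname{Dim}L/{\asymp}$ onto $\operatorname{Con_c}L$.
   Context: For a lattice $L$, the dimension monoid $\operatorname{Dim}L$ is the commutative monoid defined by generators $\Delta(a,b)$ (for $a\leq b$ in $L$) and the relations: (D0) $\Delta(a,a)=0$ for all $a\in L$; (D1) $\Delta(a,c)=\Delta(a,b)+\Delta(b,c)$ for all $a\leq b\leq c$ in $L$; (D2) $\Delta(a,a\vee b)=\Delta(a\wedge b,b)$ for all $a,b\in L$. $\operatorname{Con_c}L$ is the $\{\vee,0\}$-semilattice of all compact (= finitely generated) congruences of $L$, viewed as a commutative monoid under join; $\Theta(a,b)$ is the principal congruence of $L$ generated by the pair $\langle a,b\rangle$. The map $\langle a,b\rangle\mapsto\Theta(a,b)$ satisfies (D0), (D1), (D2), so $\rho$ exists and is unique. Every commutative monoid $M$ carries its algebraic preordering: $x\leq y$ iff there is $z\in M$ with $x+z=y$. Write $x\propto y$ if there is a positive integer $n$ with $x\leq ny$, and $x\asymp y$ if $x\propto y$ and $y\propto x$. The relation $\asymp$ is a monoid congruence and $M/{\asymp}$ is the maximal semilattice quotient of $M$. *)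

theory Defs
  imports Main "HOL-Library.Multiset"
begin

section \<open>Commutative monoids and their maximal semilattice quotients\<close>

definition monoid_hom :: "('m::comm_monoid_add \<Rightarrow> 'n::comm_monoid_add) \<Rightarrow> bool" where
  "monoid_hom f \<longleftrightarrow> f 0 = 0 \<and> (\<forall>x y. f (x + y) = f x + f y)"

definition monoid_iso :: "('m::comm_monoid_add \<Rightarrow> 'n::comm_monoid_add) \<Rightarrow> bool" where
  "monoid_iso f \<longleftrightarrow> monoid_hom f \<and> bij f"

definition alg_le :: "'m::comm_monoid_add \<Rightarrow> 'm \<Rightarrow> bool" where
  "alg_le x y \<longleftrightarrow> (\<exists>z. x + z = y)"

text \<open>The multiple \<open>n y\<close> is written as the \<open>n\<close>-fold sum of \<open>y\<close>.\<close>

definition mon_propto :: "'m::comm_monoid_add \<Rightarrow> 'm \<Rightarrow> bool" where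
  "mon_propto x y \<longleftrightarrow> (\<exists>n::nat. n > 0 \<and> alg_le x (\<Sum>i<n. y))"

definition mon_asymp :: "'m::comm_monoid_add \<Rightarrow> 'm \<Rightarrow> bool" where
  "mon_asymp x y \<longleftrightarrow> mon_propto x y \<and> mon_propto y x"

lemma alg_le_refl: "alg_le x x"
  unfolding alg_le_def by (metis add_0_right)

lemma alg_le_trans: "alg_le x y \<Longrightarrow> alg_le y z \<Longrightarrow> alg_le x z"
  unfolding alg_le_def by (metis add.assoc)

lemma alg_le_add: "alg_le x x' \<Longrightarrow> alg_le y y' \<Longrightarrow> alg_le (x + y) (x' + y')"
  unfolding alg_le_def by (metis add.assoc add.left_commute)

lemma alg_le_multiple: "alg_le x y \<Longrightarrow> alg_le (\<Sum>i<n::nat. x) (\<Sum>i<n. y)"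
  by (induction n) (simp_all add: alg_le_refl alg_le_add)

lemma multiple_plus:
  "(\<Sum>i<m + n::nat. x) = (\<Sum>i<m. x) + (\<Sum>i<n. x :: 'm::comm_monoid_add)"
  by (induction n) (simp_all add: add.assoc)

lemma multiple_times:
  "(\<Sum>i<n::nat. \<Sum>j<m::nat. x) = (\<Sum>i<n * m. x :: 'm::comm_monoid_add)"
  by (induction n) (simp_all add: multiple_plus add.commute)

lemma mon_propto_refl: "mon_propto x x"
  unfolding mon_propto_def by (rule exI[of _ 1]) (simp add: alg_le_refl)

lemma mon_propto_trans:
  assumes "mon_propto x y" "mon_propto y z"
  shows "mon_propto x z"
proof -
  obtain m n :: nat where "m > 0" "n > 0"
    and x: "alg_le x (\<Sum>i<m. y)" and y: "alg_le y (\<Sum>i<n. z)"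
    using assms unfolding mon_propto_def by blast
  moreover have "alg_le x (\<Sum>i<m * n. z)"
    using alg_le_trans[OF x alg_le_multiple[OF y]] by (simp only: multiple_times)
  ultimately show ?thesis
    unfolding mon_propto_def by (intro exI[of _ "m * n"]) simp
qed

lemma mon_propto_add:
  assumes "mon_propto x x'" "mon_propto y y'"
  shows "mon_propto (x + y) (x' + y')"
proof -
  obtain m n :: nat where "m > 0" "n > 0"
    and x: "alg_le x (\<Sum>i<m. x')" and y: "alg_le y (\<Sum>i<n. y')"
    using assms unfolding mon_propto_def by blast
  have "alg_le ((\<Sum>i<m. x') + (\<Sum>i<n. y')) (\<Sum>i<m + n. x' + y')"
    unfolding alg_le_def
    by (rule exI[of _ "(\<Sum>i<n. x') + (\<Sum>i<m. y')"])
      (simp add: multiple_plus sum.distrib ac_simps)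
  then have "alg_le (x + y) (\<Sum>i<m + n. x' + y')"
    using alg_le_add[OF x y] alg_le_trans by blast
  then show ?thesis
    unfolding mon_propto_def using \<open>m > 0\<close> by (intro exI[of _ "m + n"]) simp
qed

quotient_type (overloaded) 'm max_slat = "'m::comm_monoid_add" / mon_asymp
  morphisms rep_slat slat_class
proof (rule equivpI)
  show "reflp (mon_asymp :: 'm \<Rightarrow> 'm \<Rightarrow> bool)"
    by (rule reflpI) (simp add: mon_asymp_def mon_propto_refl)
  show "symp (mon_asymp :: 'm \<Rightarrow> 'm \<Rightarrow> bool)"
    by (rule sympI) (simp add: mon_asymp_def)
  show "transp (mon_asymp :: 'm \<Rightarrow> 'm \<Rightarrow> bool)"
    by (rule transpI) (use mon_propto_trans in \<open>unfold mon_asymp_def, blast\<close>)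
qed

instantiation max_slat :: (comm_monoid_add) comm_monoid_add
begin

lift_definition zero_max_slat :: "'a max_slat" is 0 .

lift_definition plus_max_slat :: "'a max_slat \<Rightarrow> 'a max_slat \<Rightarrow> 'a max_slat" is "(+)"
  by (simp add: mon_asymp_def mon_propto_add)

instance
  by standard (transfer; simp add: mon_asymp_def mon_propto_refl ac_simps)+

end

section \<open>The dimension monoid of a lattice\<close>

text \<open>
  The presentation is realised as a quotient of the free commutative monoid on the set of pairs
  \<open>(a, b)\<close> with \<open>a \<le> b\<close>, that is, of the finite multisets of such pairs. The relation
  \<open>dim_rel\<close> is the monoid congruence of that free monoid generated by (D0), (D1), (D2); it is a
  partial equivalence on \<open>('a \<times> 'a) multiset\<close>, reflexive exactly at the multisets all of whose
  members satisfy \<open>a \<le> b\<close>.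
\<close>

inductive dim_rel :: "('a::lattice \<times> 'a) multiset \<Rightarrow> ('a \<times> 'a) multiset \<Rightarrow> bool" where
  D0: "dim_rel {#(a, a)#} {#}"
| D1: "a \<le> b \<Longrightarrow> b \<le> c \<Longrightarrow> dim_rel {#(a, c)#} ({#(a, b)#} + {#(b, c)#})"
| D2: "dim_rel {#(a, sup a b)#} {#(inf a b, b)#}"
| refl: "(\<And>a b. (a, b) \<in># X \<Longrightarrow> a \<le> b) \<Longrightarrow> dim_rel X X"
| sym: "dim_rel X Y \<Longrightarrow> dim_rel Y X"
| trans: "dim_rel X Y \<Longrightarrow> dim_rel Y Z \<Longrightarrow> dim_rel X Z"
| add: "dim_rel X Y \<Longrightarrow> dim_rel X' Y' \<Longrightarrow> dim_rel (X + X') (Y + Y')"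

lemma dim_rel_ordered:
  assumes "dim_rel X Y"
  shows "(\<forall>(a, b) \<in># X. a \<le> b) \<and> (\<forall>(a, b) \<in># Y. a \<le> b)"
  using assms by (induction rule: dim_rel.induct) (auto intro: order_trans)

lemma dim_rel_refl_iff: "dim_rel X X \<longleftrightarrow> (\<forall>(a, b) \<in># X. a \<le> b)"
proof
  show "dim_rel X X \<Longrightarrow> \<forall>(a, b) \<in># X. a \<le> b"
    using dim_rel_ordered by (rule conjunct1)
  show "\<forall>(a, b) \<in># X. a \<le> b \<Longrightarrow> dim_rel X X"
    by (rule dim_rel.refl) (drule (1) bspec, simp)
qed

quotient_type (overloaded) 'a dim_monoid = "('a::lattice \<times> 'a) multiset" / partial: dim_rel
proof (rule part_equivpI)
  show "\<exists>X :: ('a \<times> 'a) multiset. dim_rel X X"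
    by (rule exI[of _ "{#}"]) (rule dim_rel.refl, simp)
  show "symp (dim_rel :: ('a \<times> 'a) multiset \<Rightarrow> _)"
    by (rule sympI) (rule dim_rel.sym)
  show "transp (dim_rel :: ('a \<times> 'a) multiset \<Rightarrow> _)"
    by (rule transpI) (rule dim_rel.trans)
qed

instantiation dim_monoid :: (lattice) comm_monoid_add
begin

lift_definition zero_dim_monoid :: "'a dim_monoid" is "{#}"
  by (rule dim_rel.refl) simp

lift_definition plus_dim_monoid :: "'a dim_monoid \<Rightarrow> 'a dim_monoid \<Rightarrow> 'a dim_monoid" is "(+)"
  by (rule dim_rel.add)

instance
  by standard (transfer; simp add: ac_simps dim_rel.add)+

end

text \<open>Only meaningful for \<open>a \<le> b\<close>; the value is unspecified otherwise.\<close>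

definition Delta :: "'a::lattice \<Rightarrow> 'a \<Rightarrow> 'a dim_monoid" where
  "Delta a b = abs_dim_monoid {#(a, b)#}"

section \<open>Finitely generated lattice congruences\<close>

definition lattice_cong :: "('a::lattice \<times> 'a) set \<Rightarrow> bool" where
  "lattice_cong \<theta> \<longleftrightarrow> equiv UNIV \<theta> \<and>
     (\<forall>a b c d. (a, b) \<in> \<theta> \<longrightarrow> (c, d) \<in> \<theta> \<longrightarrow>
        (sup a c, sup b d) \<in> \<theta> \<and> (inf a c, inf b d) \<in> \<theta>)"

definition cong_gen :: "('a::lattice \<times> 'a) set \<Rightarrow> ('a \<times> 'a) set" where
  "cong_gen R = \<Inter> {\<theta>. lattice_cong \<theta> \<and> R \<subseteq> \<theta>}"

lemma lattice_cong_cong_gen: "lattice_cong (cong_gen R)"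
proof -
  have "equiv UNIV (cong_gen R)"
  proof (rule equivI)
    show "refl (cong_gen R)"
      unfolding cong_gen_def lattice_cong_def equiv_def refl_on_def by blast
    show "sym (cong_gen R)"
      unfolding cong_gen_def lattice_cong_def equiv_def sym_def by blast
    show "trans (cong_gen R)"
    proof (rule transI)
      fix x y z
      assume xy: "(x, y) \<in> cong_gen R" and yz: "(y, z) \<in> cong_gen R"
      have "(x, z) \<in> \<theta>" if \<theta>: "lattice_cong \<theta>" "R \<subseteq> \<theta>" for \<theta>
      proof -
        have "trans \<theta>" using \<theta> by (simp add: lattice_cong_def equiv_def)
        moreover have "(x, y) \<in> \<theta>" "(y, z) \<in> \<theta>"
          using xy yz \<theta> by (auto simp: cong_gen_def)
        ultimately show ?thesis by (rule transD)
      qed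
      then show "(x, z) \<in> cong_gen R" by (simp add: cong_gen_def)
    qed
  qed simp
  then show ?thesis
    unfolding lattice_cong_def cong_gen_def by simp
qed

lemma cong_gen_superset: "R \<subseteq> cong_gen R"
  unfolding cong_gen_def by blast

lemma cong_gen_least: "lattice_cong \<theta> \<Longrightarrow> R \<subseteq> \<theta> \<Longrightarrow> cong_gen R \<subseteq> \<theta>"
  unfolding cong_gen_def by blast

lemma cong_gen_Un: "cong_gen (cong_gen R \<union> cong_gen S) = cong_gen (R \<union> S)"
proof
  have "cong_gen R \<subseteq> cong_gen (R \<union> S)" "cong_gen S \<subseteq> cong_gen (R \<union> S)"
    using cong_gen_superset[of "R \<union> S"] by (intro cong_gen_least lattice_cong_cong_gen; blast)+
  then show "cong_gen (cong_gen R \<union> cong_gen S) \<subseteq> cong_gen (R \<union> S)"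
    by (rule cong_gen_least[OF lattice_cong_cong_gen Un_least])
  have "R \<union> S \<subseteq> cong_gen (cong_gen R \<union> cong_gen S)"
    using cong_gen_superset[of R] cong_gen_superset[of S]
      cong_gen_superset[of "cong_gen R \<union> cong_gen S"] by blast
  then show "cong_gen (R \<union> S) \<subseteq> cong_gen (cong_gen R \<union> cong_gen S)"
    by (intro cong_gen_least lattice_cong_cong_gen)
qed

text \<open>
  The compact elements of the congruence lattice are exactly the finitely generated congruences.
\<close>

typedef (overloaded) 'a con_c = "{cong_gen R | R :: ('a::lattice \<times> 'a) set. finite R}"
  by blast

setup_lifting type_definition_con_c

instantiation con_c :: (lattice) bounded_semilattice_sup_bot
begin

lift_definition less_eq_con_c :: "'a con_c \<Rightarrow> 'a con_c \<Rightarrow> bool" is "(\<subseteq>)" .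

lift_definition less_con_c :: "'a con_c \<Rightarrow> 'a con_c \<Rightarrow> bool" is "(\<subset>)" .

lift_definition bot_con_c :: "'a con_c" is "cong_gen {}"
  by blast

lift_definition sup_con_c :: "'a con_c \<Rightarrow> 'a con_c \<Rightarrow> 'a con_c" is "\<lambda>\<theta> \<psi>. cong_gen (\<theta> \<union> \<psi>)"
  by (auto simp: cong_gen_Un)

instance
proof
  fix x y z :: "'a con_c"
  show "x < y \<longleftrightarrow> x \<le> y \<and> \<not> y \<le> x" by transfer (rule less_le_not_le)
  show "x \<le> x" by transfer (rule subset_refl)
  show "x \<le> y \<Longrightarrow> y \<le> z \<Longrightarrow> x \<le> z" by transfer (rule subset_trans)
  show "x \<le> y \<Longrightarrow> y \<le> x \<Longrightarrow> x = y" by transfer (rule subset_antisym)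
  show "x \<le> sup x y" by transfer (rule order_trans[OF Un_upper1 cong_gen_superset])
  show "y \<le> sup x y" by transfer (rule order_trans[OF Un_upper2 cong_gen_superset])
  show "y \<le> x \<Longrightarrow> z \<le> x \<Longrightarrow> sup y z \<le> x"
    by transfer (rule cong_gen_least, auto simp: lattice_cong_cong_gen)
  show "bot \<le> x"
    by transfer (rule cong_gen_least, auto simp: lattice_cong_cong_gen)
qed

end

instantiation con_c :: (lattice) comm_monoid_add
begin

definition zero_con_c :: "'a con_c" where "zero_con_c = bot"

definition plus_con_c :: "'a con_c \<Rightarrow> 'a con_c \<Rightarrow> 'a con_c" where "plus_con_c = sup"

instance
  by standard (simp_all add: zero_con_c_def plus_con_c_def ac_simps)

end

lift_definition Theta :: "'a::lattice \<Rightarrow> 'a \<Rightarrow> 'a con_c" is "\<lambda>a b. cong_gen {(a, b)}"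
  by blast

definition natural_hom :: "('a::lattice dim_monoid \<Rightarrow> 'a con_c) \<Rightarrow> bool" where
  "natural_hom \<rho> \<longleftrightarrow> monoid_hom \<rho> \<and> (\<forall>a b. a \<le> b \<longrightarrow> \<rho> (Delta a b) = Theta a b)"

end

theory Submission imports Defs begin

text \<open>
  Write \<open>\<propto>\<close> for \<^const>\<open>mon_propto\<close>. Everything rests on the equivalence
  \<open>\<rho> x \<le> \<rho> y \<longleftrightarrow> x \<propto> y\<close> (lemma \<open>natural_hom_le_iff\<close>): it says at once that \<open>\<rho>\<close> factors
  through the quotient by \<^const>\<open>mon_asymp\<close> and that the induced map is injective. Uniqueness and
  surjectivity hold because the two monoids are generated by the values of \<^const>\<open>Delta\<close> and of
  \<^const>\<open>Theta\<close>, respectively, on pairs \<open>a \<le> b\<close>; existence holds because the two sides of each of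
  (D0), (D1), (D2) generate the same congruence.

  The implication from right to left uses only that addition in \<open>Con\<^sub>c L\<close> is the join. For the other
  one, fix \<open>y\<close> and identify \<open>a\<close> and \<open>b\<close> when \<open>\<Delta>(a \<and> b, a \<or> b) \<propto> y\<close>. The elements
  \<open>x \<propto> y\<close> are closed under sums and summands, so (D0), (D1), (D2) turn into closure properties of the
  set of intervals \<open>[a, b]\<close> with \<open>\<Delta>(a, b) \<propto> y\<close>, and these are exactly what is needed for the
  identification to be a lattice congruence (lemma \<open>lattice_cong_interval_cong\<close>). This congruence
  contains the generators of \<open>\<rho> y\<close>, hence all of \<open>\<rho> y\<close>; so if \<open>\<Theta>(a, b) \<le> \<rho> y\<close> then
  \<open>\<Delta>(a, b) \<propto> y\<close>.
\<close>

section \<open>Congruences from sets of intervals\<close>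

definition interval_cong :: "('a::lattice \<Rightarrow> 'a \<Rightarrow> bool) \<Rightarrow> ('a \<times> 'a) set" where
  "interval_cong J = {(a, b). J (inf a b) (sup a b)}"

text \<open>
  The three hypotheses are (D0), (D1), (D2) read in a two-element semilattice: \<open>J a b\<close> says that the
  interval \<open>[a, b]\<close> is to be collapsed. By (D1), \<open>J\<close> passes to subintervals. By (D2), the interval
  \<open>[a \<or> c, b \<or> c]\<close> is perspective to a subinterval of \<open>[a, b]\<close>, and dually for meets, so \<open>J\<close> is
  preserved by joining and meeting with \<open>c\<close>.
\<close>

lemma lattice_cong_interval_cong:
  fixes J :: "'a::lattice \<Rightarrow> 'a \<Rightarrow> bool"
  assumes D0: "\<And>a. J a a"
    and D1: "\<And>a b c. a \<le> b \<Longrightarrow> b \<le> c \<Longrightarrow> J a c \<longleftrightarrow> J a b \<and> J b c"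
    and D2: "\<And>a b. J a (sup a b) \<longleftrightarrow> J (inf a b) b"
  shows "lattice_cong (interval_cong J)"
proof -
  have subinterval: "J a' b'" if "J a b" "a \<le> a'" "a' \<le> b'" "b' \<le> b" for a b a' b'
    using that by (meson D1 order_trans)
  have J_sup: "J (sup a c) (sup b c)" if "J a b" "a \<le> b" for a b c
  proof -
    have "J (inf (sup a c) b) b"
      using subinterval[OF \<open>J a b\<close>, of "inf (sup a c) b" b] that by simp
    then have "J (sup a c) (sup (sup a c) b)"
      using D2 by blast
    moreover have "sup (sup a c) b = sup b c"
      using \<open>a \<le> b\<close> by (metis sup.absorb2 sup.assoc sup.commute)
    ultimately show ?thesis by simp
  qed
  have J_inf: "J (inf a c) (inf b c)" if "J a b" "a \<le> b" for a b c
  proof -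
    have "J a (sup a (inf b c))"
      using subinterval[OF \<open>J a b\<close>, of a "sup a (inf b c)"] that by (simp add: le_infI1)
    then have "J (inf a (inf b c)) (inf b c)"
      using D2 by blast
    moreover have "inf a (inf b c) = inf a c"
      using \<open>a \<le> b\<close> by (metis inf.absorb1 inf.assoc)
    ultimately show ?thesis by simp
  qed
  let ?\<theta> = "interval_cong J"
  have trans: "(a, c) \<in> ?\<theta>" if ab: "(a, b) \<in> ?\<theta>" and bc: "(b, c) \<in> ?\<theta>" for a b c
  proof -
    have ab': "J (inf a b) (sup a b)" and bc': "J (inf b c) (sup b c)"
      using ab bc by (auto simp: interval_cong_def)
    \<comment> \<open>The interval from \<open>a \<and> b \<and> c\<close> to \<open>a \<or> b \<or> c\<close> is cut at \<open>a \<and> b\<close> and \<open>a \<or> b\<close>; the outer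
      pieces arise from \<open>[b \<and> c, b \<or> c]\<close> on meeting with \<open>a \<and> b\<close> and joining with \<open>a \<or> b\<close>.\<close>
    have "J (sup (inf b c) (sup a b)) (sup (sup b c) (sup a b))"
      by (rule J_sup[OF bc']) (simp add: le_infI1)
    moreover have "sup (inf b c) (sup a b) = sup a b"
      by (simp add: sup.absorb2 le_infI1)
    moreover have "sup (sup b c) (sup a b) = sup (sup a b) c"
      by (simp add: ac_simps)
    ultimately have top: "J (sup a b) (sup (sup a b) c)" by simp
    have "J (inf (inf b c) (inf a b)) (inf (sup b c) (inf a b))"
      by (rule J_inf[OF bc']) (simp add: le_infI1)
    moreover have "inf (sup b c) (inf a b) = inf a b"
      by (simp add: inf.absorb2 le_infI2)
    moreover have "inf (inf b c) (inf a b) = inf (inf a b) c"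
      by (simp add: ac_simps)
    ultimately have bottom: "J (inf (inf a b) c) (inf a b)" by simp
    have "J (inf (inf a b) c) (sup a b)"
      using bottom ab' by (subst D1[of _ "inf a b"]) (auto simp: le_infI1 le_supI1)
    with top have "J (inf (inf a b) c) (sup (sup a b) c)"
      by (subst D1[of _ "sup a b"]) (auto simp: le_infI1 le_supI1)
    then have "J (inf a c) (sup a c)"
      by (rule subinterval) (auto simp: le_infI1 le_supI1)
    then show ?thesis by (simp add: interval_cong_def)
  qed
  have sym: "(b, a) \<in> ?\<theta>" if "(a, b) \<in> ?\<theta>" for a b
    using that by (simp add: interval_cong_def inf.commute sup.commute)
  \<comment> \<open>Distributivity may fail, but \<open>(a \<and> b) \<or> c\<close> always lies below \<open>(a \<or> c) \<and> (b \<or> c)\<close>, so \<open>J\<close>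
    passes to the subinterval that is needed; dually for meets.\<close>
  have sup_right: "(sup a c, sup b c) \<in> ?\<theta>" if "(a, b) \<in> ?\<theta>" for a b c
  proof -
    have "J (sup (inf a b) c) (sup (sup a b) c)"
      using that by (intro J_sup) (auto simp: interval_cong_def le_infI1)
    then have "J (inf (sup a c) (sup b c)) (sup (sup a c) (sup b c))"
      by (rule subinterval) (auto simp: le_infI1 le_supI1)
    then show ?thesis by (simp add: interval_cong_def)
  qed
  have inf_right: "(inf a c, inf b c) \<in> ?\<theta>" if "(a, b) \<in> ?\<theta>" for a b c
  proof -
    have "J (inf (inf a b) c) (inf (sup a b) c)"
      using that by (intro J_inf) (auto simp: interval_cong_def le_infI1)
    then have "J (inf (inf a c) (inf b c)) (sup (inf a c) (inf b c))"
      by (rule subinterval) (auto simp: le_infI1 le_supI1)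
    then show ?thesis by (simp add: interval_cong_def)
  qed
  have "equiv UNIV ?\<theta>"
  proof (rule equivI)
    show "refl ?\<theta>" by (simp add: refl_on_def interval_cong_def D0)
    show "Relation.sym ?\<theta>" using sym by (rule symI)
    show "Relation.trans ?\<theta>" using trans by (rule transI)
  qed simp
  moreover have "(sup a c, sup b d) \<in> ?\<theta> \<and> (inf a c, inf b d) \<in> ?\<theta>"
    if "(a, b) \<in> ?\<theta>" "(c, d) \<in> ?\<theta>" for a b c d
    using trans sup_right[OF that(1), of c] sup_right[OF that(2), of b]
      inf_right[OF that(1), of c] inf_right[OF that(2), of b]
    by (metis sup.commute inf.commute)
  ultimately show ?thesis unfolding lattice_cong_def by blast
qed

section \<open>Elements below a multiple of a given one\<close>

lemma alg_le_imp_mon_propto: "alg_le x y \<Longrightarrow> mon_propto x y"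
  unfolding mon_propto_def by (rule exI[of _ 1]) simp

lemma mon_propto_zero: "mon_propto 0 y"
  by (rule alg_le_imp_mon_propto) (simp add: alg_le_def)

lemma mon_propto_add_iff: "mon_propto (x + x') y \<longleftrightarrow> mon_propto x y \<and> mon_propto x' y"
proof
  have "mon_propto x (x + x')" "mon_propto x' (x + x')"
    by (rule alg_le_imp_mon_propto, unfold alg_le_def, metis add.commute)+
  then show "mon_propto x y \<and> mon_propto x' y" if "mon_propto (x + x') y"
    using that mon_propto_trans by blast
next
  have "mon_propto (y + y) y"
    unfolding mon_propto_def
    by (rule exI[of _ 2]) (simp add: numeral_2_eq_2 alg_le_refl)
  then show "mon_propto (x + x') y" if "mon_propto x y \<and> mon_propto x' y"
    using that mon_propto_add mon_propto_trans by blast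
qed

section \<open>The generators of the two monoids\<close>

lemma abs_dim_monoid_eq: "dim_rel X Y \<Longrightarrow> abs_dim_monoid X = abs_dim_monoid Y"
  using Quotient3_rel[OF Quotient3_dim_monoid, of X Y] by blast

lemma abs_dim_monoid_add:
  assumes "dim_rel X X" "dim_rel Y Y"
  shows "abs_dim_monoid (X + Y) = abs_dim_monoid X + abs_dim_monoid Y"
  using plus_dim_monoid.abs_eq[OF assms] by simp

lemma dim_rel_singleton: "a \<le> b \<Longrightarrow> dim_rel {#(a, b)#} {#(a, b)#}"
  by (rule dim_rel.refl) simp

lemma Delta_self: "Delta a a = 0"
  unfolding Delta_def zero_dim_monoid.abs_eq by (rule abs_dim_monoid_eq) (rule dim_rel.D0)

lemma Delta_add: "a \<le> b \<Longrightarrow> b \<le> c \<Longrightarrow> Delta a c = Delta a b + Delta b c"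
  unfolding Delta_def
  by (subst abs_dim_monoid_add[symmetric])
    (auto intro: abs_dim_monoid_eq dim_rel_singleton dim_rel.D1[simplified])

lemma Delta_sup_inf: "Delta a (sup a b) = Delta (inf a b) b"
  unfolding Delta_def by (rule abs_dim_monoid_eq) (rule dim_rel.D2)

lemma dim_monoid_induct [case_names zero add]:
  fixes z :: "'a::lattice dim_monoid"
  assumes zero: "P 0"
    and add: "\<And>a b x. a \<le> b \<Longrightarrow> P x \<Longrightarrow> P (Delta a b + x)"
  shows "P z"
proof (induction z rule: dim_monoid.abs_induct)
  fix X :: "('a \<times> 'a) multiset"
  assume "dim_rel X X"
  then show "P (abs_dim_monoid X)"
  proof (induction X rule: multiset_induct)
    case empty
    then show ?case using zero by (simp add: zero_dim_monoid.abs_eq)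
  next
    case (add p X)
    obtain a b where p: "p = (a, b)" by fastforce
    have "a \<le> b" and X: "dim_rel X X"
      using add.prems by (auto simp: p dim_rel_refl_iff)
    have "abs_dim_monoid (add_mset p X) = Delta a b + abs_dim_monoid X"
      using abs_dim_monoid_add[OF dim_rel_singleton[OF \<open>a \<le> b\<close>] X] by (simp add: Delta_def p)
    then show ?case using assms(2) \<open>a \<le> b\<close> add.IH[OF X] by simp
  qed
qed

lemma lattice_congD:
  assumes "lattice_cong \<theta>"
  shows "(a, a) \<in> \<theta>" "(a, b) \<in> \<theta> \<Longrightarrow> (b, a) \<in> \<theta>"
    "(a, b) \<in> \<theta> \<Longrightarrow> (b, c) \<in> \<theta> \<Longrightarrow> (a, c) \<in> \<theta>"
    "(a, b) \<in> \<theta> \<Longrightarrow> (sup a c, sup b c) \<in> \<theta>" "(a, b) \<in> \<theta> \<Longrightarrow> (inf a c, inf b c) \<in> \<theta>"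
  using assms unfolding lattice_cong_def equiv_def refl_on_def
  by (blast dest: symD transD)+

lemma cong_gen_eqI:
  assumes "R \<subseteq> cong_gen S" "S \<subseteq> cong_gen R"
  shows "cong_gen R = cong_gen S"
  using assms by (intro equalityI cong_gen_least lattice_cong_cong_gen)

lemma cong_gen_inf_sup: "cong_gen {(inf a b, sup a b)} = cong_gen {(a, b)}"
proof (rule cong_gen_eqI; clarsimp)
  let ?\<theta> = "cong_gen {(a, b)}"
  note \<theta> = lattice_congD[OF lattice_cong_cong_gen[of "{(a, b)}"]]
  have ab: "(a, b) \<in> ?\<theta>" using cong_gen_superset by blast
  have "(inf a b, b) \<in> ?\<theta>" using \<theta>(5)[OF ab, of b] by simp
  moreover have "(sup a b, b) \<in> ?\<theta>" using \<theta>(4)[OF ab, of b] by simp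
  ultimately show "(inf a b, sup a b) \<in> ?\<theta>" using \<theta>(2,3) by blast
next
  let ?\<psi> = "cong_gen {(inf a b, sup a b)}"
  note \<psi> = lattice_congD[OF lattice_cong_cong_gen[of "{(inf a b, sup a b)}"]]
  have I: "(inf a b, sup a b) \<in> ?\<psi>" using cong_gen_superset by blast
  have "(a, sup a b) \<in> ?\<psi>" using \<psi>(4)[OF I, of a] by (simp add: sup.absorb1 sup.absorb2 ac_simps)
  moreover have "(b, sup a b) \<in> ?\<psi>"
    using \<psi>(4)[OF I, of b] by (simp add: sup.absorb1 sup.absorb2 ac_simps)
  ultimately show "(a, b) \<in> ?\<psi>" using \<psi>(2,3) by blast
qed

lemma Theta_inf_sup: "Theta (inf a b) (sup a b) = Theta a b"
  by transfer (rule cong_gen_inf_sup)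

text \<open>
  The generators can be restricted to \<open>a \<le> b\<close>, where \<^const>\<open>Theta\<close> is the image of
  \<^const>\<open>Delta\<close>, because a congruence identifies \<open>a\<close> and \<open>b\<close> just when it collapses the interval
  from \<open>a \<and> b\<close> to \<open>a \<or> b\<close>.
\<close>

lemma con_c_induct [case_names zero add]:
  fixes \<beta> :: "'a::lattice con_c"
  assumes zero: "P 0"
    and add: "\<And>a b \<alpha>. a \<le> b \<Longrightarrow> P \<alpha> \<Longrightarrow> P (Theta a b + \<alpha>)"
  shows "P \<beta>"
proof (cases \<beta>)
  case (Abs_con_c \<theta>)
  then obtain R where R: "finite R" and \<theta>: "\<theta> = cong_gen R" by blast
  have "P (Abs_con_c (cong_gen R))"
    using R
  proof (induction R)
    case empty
    then show ?case using zero by (simp add: zero_con_c_def bot_con_c_def)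
  next
    case (insert p R)
    obtain a b where p: "p = (a, b)" by fastforce
    have "Rep_con_c (Abs_con_c (cong_gen R)) = cong_gen R"
      using \<open>finite R\<close> by (intro Abs_con_c_inverse) blast
    then have "Abs_con_c (cong_gen (insert p R)) = Theta a b + Abs_con_c (cong_gen R)"
      using cong_gen_Un[of "{(a, b)}" R]
      by (simp add: p plus_con_c_def sup_con_c_def Theta.rep_eq)
    also have "\<dots> = Theta (inf a b) (sup a b) + Abs_con_c (cong_gen R)"
      by (simp add: Theta_inf_sup)
    finally show ?case
      using add[of "inf a b" "sup a b"] insert.IH by (simp add: le_infI1)
  qed
  then show ?thesis by (simp add: Abs_con_c \<theta>)
qed

section \<open>The natural homomorphism\<close>

lemma cong_gen_eq_of_dim_rel:
  "dim_rel X Y \<Longrightarrow> cong_gen (set_mset X) = cong_gen (set_mset Y)"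
proof (induction rule: dim_rel.induct)
  case (D0 a)
  show ?case
    by (rule cong_gen_eqI) (auto simp: lattice_congD[OF lattice_cong_cong_gen])
next
  case (D1 a b c)
  let ?\<theta> = "cong_gen {(a, c)}"
  note \<theta> = lattice_congD[OF lattice_cong_cong_gen[of "{(a, c)}"]]
  have ac: "(a, c) \<in> ?\<theta>" using cong_gen_superset by blast
  have "(a, b) \<in> ?\<theta>" "(b, c) \<in> ?\<theta>"
    using \<theta>(5)[OF ac, of b] \<theta>(4)[OF ac, of b] D1
    by (simp_all add: inf.absorb1 inf.absorb2 sup.absorb1 sup.absorb2)
  moreover have "(a, c) \<in> cong_gen {(a, b), (b, c)}"
    using cong_gen_superset[of "{(a, b), (b, c)}"]
      lattice_congD(3)[OF lattice_cong_cong_gen, of a b "{(a, b), (b, c)}" c] by blast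
  ultimately show ?case by (intro cong_gen_eqI) (simp_all add: insert_commute)
next
  case (D2 a b)
  have "(a, sup a b) \<in> cong_gen {(inf a b, b)}"
    using lattice_congD(4)[OF lattice_cong_cong_gen, of "inf a b" b "{(inf a b, b)}" a]
      cong_gen_superset[of "{(inf a b, b)}"] by (simp add: sup.absorb2 sup.commute)
  moreover have "(inf a b, b) \<in> cong_gen {(a, sup a b)}"
    using lattice_congD(5)[OF lattice_cong_cong_gen, of a "sup a b" "{(a, sup a b)}" b]
      cong_gen_superset[of "{(a, sup a b)}"] by (simp add: inf.absorb2)
  ultimately show ?case by (intro cong_gen_eqI) simp_all
next
  case (add X Y X' Y')
  then show ?case by (metis cong_gen_Un set_mset_union)
qed simp_all

lift_definition cong_hom :: "'a::lattice dim_monoid \<Rightarrow> 'a con_c" is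
  "\<lambda>X. cong_gen (set_mset X)"
  by (auto simp: eq_onp_def cong_gen_eq_of_dim_rel)

lemma natural_hom_cong_hom: "natural_hom cong_hom"
proof -
  have "cong_hom 0 = 0"
    unfolding zero_con_c_def by transfer simp
  moreover have "cong_hom (x + y) = cong_hom x + cong_hom y" for x y :: "'a dim_monoid"
    unfolding plus_con_c_def by transfer (simp add: cong_gen_Un)
  moreover have "cong_hom (Delta a b) = Theta a b" if "a \<le> b" for a b :: 'a
    using dim_rel_singleton[OF that] by (simp add: Delta_def cong_hom.abs_eq Theta_def)
  ultimately show ?thesis by (simp add: natural_hom_def monoid_hom_def)
qed

lemma natural_hom_unique:
  assumes "natural_hom \<rho>" "natural_hom \<rho>'"
  shows "\<rho> = \<rho>'"
proof
  fix x show "\<rho> x = \<rho>' x"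
    using assms by (induction x rule: dim_monoid_induct) (auto simp: natural_hom_def monoid_hom_def)
qed

lemma natural_hom_surj:
  assumes "natural_hom \<rho>"
  shows "surj \<rho>"
proof -
  have "\<exists>x. \<rho> x = \<beta>" for \<beta>
  proof (induction \<beta> rule: con_c_induct)
    case zero
    show ?case using assms by (auto simp: natural_hom_def monoid_hom_def)
  next
    case (add a b \<alpha>)
    then show ?case using assms unfolding natural_hom_def monoid_hom_def by metis
  qed
  then show ?thesis by (metis surj_def)
qed

section \<open>Comparison of images under the natural homomorphism\<close>

lemma mon_propto_imp_le:
  fixes \<rho> :: "'m::comm_monoid_add \<Rightarrow> 'a::lattice con_c"
  assumes "monoid_hom \<rho>" "mon_propto x y"
  shows "\<rho> x \<le> \<rho> y"
proof -
  obtain n :: nat and z where z: "x + z = (\<Sum>i<n. y)"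
    using assms(2) unfolding mon_propto_def alg_le_def by blast
  have "\<rho> (\<Sum>i<n. y) \<le> \<rho> y" for n :: nat
    using assms(1) by (induction n) (auto simp: monoid_hom_def zero_con_c_def plus_con_c_def)
  then show ?thesis
    using assms(1) z by (metis monoid_hom_def plus_con_c_def le_sup_iff)
qed

lemma Theta_le_iff: "Theta a b \<le> \<alpha> \<longleftrightarrow> (a, b) \<in> Rep_con_c \<alpha>"
  by transfer (use cong_gen_superset cong_gen_least lattice_cong_cong_gen in blast)

text \<open>
  Any decomposition of \<open>y\<close> into generators \<open>\<Delta>(a, b)\<close> exhibits \<open>\<rho> y\<close> as the join of the
  \<open>\<Theta>(a, b)\<close>. As \<open>y\<close> does not determine the decomposition, the hypothesis refers instead to all
  \<open>\<Delta>(a, b) \<le> y\<close>, which include the generators in every one.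
\<close>

lemma natural_hom_subset_congruence:
  assumes "natural_hom \<rho>" "lattice_cong \<theta>"
    and "\<And>a b. a \<le> b \<Longrightarrow> alg_le (Delta a b) y \<Longrightarrow> (a, b) \<in> \<theta>"
  shows "Rep_con_c (\<rho> y) \<subseteq> \<theta>"
  using assms(3)
proof (induction y rule: dim_monoid_induct)
  case zero
  have "\<rho> 0 = bot"
    using assms(1) by (simp add: natural_hom_def monoid_hom_def zero_con_c_def)
  then show ?case
    by (simp add: bot_con_c.rep_eq cong_gen_least[OF assms(2)])
next
  case (add a b x)
  have "(a, b) \<in> \<theta>"
    using add.prems \<open>a \<le> b\<close> by (auto simp: alg_le_def)
  then have "cong_gen {(a, b)} \<subseteq> \<theta>"
    by (simp add: cong_gen_least[OF assms(2)])
  moreover have "Rep_con_c (\<rho> x) \<subseteq> \<theta>"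
    using add.prems by (intro add.IH) (metis alg_le_def add.left_commute)
  moreover have "\<rho> (Delta a b + x) = sup (Theta a b) (\<rho> x)"
    using assms(1) \<open>a \<le> b\<close> by (simp add: natural_hom_def monoid_hom_def plus_con_c_def)
  ultimately show ?case
    by (simp add: sup_con_c.rep_eq Theta.rep_eq cong_gen_least[OF assms(2)])
qed

text \<open>
  The elements \<open>x \<propto> y\<close> contain \<open>0\<close> and are closed under sums and summands, so the intervals whose
  \<^const>\<open>Delta\<close> is among them define a congruence; it contains the generators of \<open>\<rho> y\<close>.
\<close>

lemma Theta_le_imp_mon_propto:
  assumes "natural_hom \<rho>" "a \<le> b" "Theta a b \<le> \<rho> y"
  shows "mon_propto (Delta a b) y"
proof -
  define J where "J a b \<longleftrightarrow> mon_propto (Delta a b) y" for a b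
  have "lattice_cong (interval_cong J)"
  proof (rule lattice_cong_interval_cong)
    show "J a a" for a
      by (simp add: J_def Delta_self mon_propto_zero)
    show "J a c \<longleftrightarrow> J a b \<and> J b c" if "a \<le> b" "b \<le> c" for a b c
      using Delta_add[OF that] by (simp add: J_def mon_propto_add_iff)
    show "J a (sup a b) \<longleftrightarrow> J (inf a b) b" for a b
      by (simp add: J_def Delta_sup_inf)
  qed
  then have "Rep_con_c (\<rho> y) \<subseteq> interval_cong J"
    by (rule natural_hom_subset_congruence[OF assms(1)])
      (simp add: interval_cong_def J_def inf.absorb1 sup.absorb2 alg_le_imp_mon_propto)
  moreover have "(a, b) \<in> Rep_con_c (\<rho> y)"
    using assms(3) by (simp add: Theta_le_iff)
  ultimately show ?thesis
    using \<open>a \<le> b\<close> by (auto simp: interval_cong_def J_def inf.absorb1 sup.absorb2)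
qed

text \<open>
  Both sides of the equivalence turn a sum in place of \<open>x\<close> into a conjunction. Hence the generators of
  \<open>x\<close> can be treated one at a time.
\<close>

lemma natural_hom_le_iff:
  assumes "natural_hom \<rho>"
  shows "\<rho> x \<le> \<rho> y \<longleftrightarrow> mon_propto x y"
proof
  show "mon_propto x y \<Longrightarrow> \<rho> x \<le> \<rho> y"
    using assms by (simp add: natural_hom_def mon_propto_imp_le)
  show "\<rho> x \<le> \<rho> y \<Longrightarrow> mon_propto x y"
  proof (induction x rule: dim_monoid_induct)
    case zero
    show ?case by (rule mon_propto_zero)
  next
    case (add a b x)
    have "\<rho> (Delta a b + x) = sup (Theta a b) (\<rho> x)"
      using assms \<open>a \<le> b\<close> by (simp add: natural_hom_def monoid_hom_def plus_con_c_def)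
    then show ?case
      using add assms Theta_le_imp_mon_propto by (auto simp: mon_propto_add_iff)
  qed
qed

corollary natural_hom_eq_iff:
  "natural_hom \<rho> \<Longrightarrow> \<rho> x = \<rho> y \<longleftrightarrow> mon_asymp x y"
  by (simp add: eq_iff natural_hom_le_iff mon_asymp_def)

theorem corollary2p3:
  "(\<exists>!\<rho> :: 'a::lattice dim_monoid \<Rightarrow> 'a con_c. natural_hom \<rho>) \<and>
   (\<forall>\<rho> :: 'a dim_monoid \<Rightarrow> 'a con_c. natural_hom \<rho> \<longrightarrow>
      (\<exists>\<phi> :: 'a dim_monoid max_slat \<Rightarrow> 'a con_c.
         (\<forall>x. \<phi> (slat_class x) = \<rho> x) \<and> monoid_iso \<phi>))"
proof (intro conjI allI impI)
  show "\<exists>!\<rho> :: 'a dim_monoid \<Rightarrow> 'a con_c. natural_hom \<rho>"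
    using natural_hom_cong_hom natural_hom_unique by blast
next
  fix \<rho> :: "'a dim_monoid \<Rightarrow> 'a con_c"
  assume \<rho>: "natural_hom \<rho>"
  define \<phi> where "\<phi> s = \<rho> (rep_slat s)" for s
  have \<phi>: "\<phi> (slat_class x) = \<rho> x" for x
  proof -
    have "slat_class (rep_slat (slat_class x)) = slat_class x"
      by (rule Quotient3_abs_rep[OF Quotient3_max_slat])
    then show ?thesis
      by (simp add: \<phi>_def natural_hom_eq_iff[OF \<rho>] max_slat.abs_eq_iff)
  qed
  have "\<phi> 0 = 0" and "\<phi> (s + t) = \<phi> s + \<phi> t" for s t
    using \<rho> by (simp add: zero_max_slat_def \<phi> natural_hom_def monoid_hom_def)
      (induction s rule: max_slat.abs_induct, induction t rule: max_slat.abs_induct,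
        use \<rho> in \<open>simp add: plus_max_slat.abs_eq \<phi> natural_hom_def monoid_hom_def\<close>)
  moreover have "inj \<phi>"
  proof (rule injI)
    fix s t
    show "\<phi> s = \<phi> t \<Longrightarrow> s = t"
      by (induction s rule: max_slat.abs_induct, induction t rule: max_slat.abs_induct)
        (simp add: \<phi> natural_hom_eq_iff[OF \<rho>] max_slat.abs_eq_iff)
  qed
  moreover have "surj \<phi>"
    using natural_hom_surj[OF \<rho>] \<phi> by (metis surj_def)
  ultimately have "monoid_iso \<phi>"
    by (simp add: monoid_iso_def monoid_hom_def bij_def)
  with \<phi> show "\<exists>\<phi>. (\<forall>x. \<phi> (slat_class x) = \<rho> x) \<and> monoid_iso \<phi>" by blast
qed

end
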